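(* Let $\beta_1,\beta_2\in[0,1)$, $0<g<\infty$ and $k>0$ be real numbers. For each positive integer $t'$, run Adam-Rel with $\epsilon=0$ on a single parameter coordinate $i$, starting at timestep $-t'$, with the gradient sequence $$g_t^i=\begin{cases} g, & -t'\le t<0,\\ kg, & t\ge 0,\end{cases}$$ where the step counter used in the bias correction is reset to $0$ just before the gradient at timestep $0$ is processed (the moment estimates being retained). Let $\hat m_{-t',t}^i$ and $\hat v_{-t',t}^i$ be the resulting bias-corrected first and second momentum terms at timestep $t$. Then for every integer $t\ge 0$, $$\lim_{t'\to\infty}\frac{\hat m_{-t',t}^i}{\sqrt{\hat v_{-t',t}^i}}=\frac{\sqrt{1-\beta_2^{t+1}}}{1-\beta_1^{t+1}}\cdot\frac{\beta_1^{t+1}+k\,(1-\beta_1^{t+1})}{\sqrt{\beta_2^{t+1}+k^2(1-\beta_2^{t+1})}},$$ and, for each fixed $t\ge 0$, the right-hand side tends to $1$ as $k\to\infty$.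
   Context: Adam-Rel is Adam in which, at a change of objective, the step counter used for bias correction is reset to $0$ while the moment estimates are kept. Concretely, in the setting considered: the uncorrected moments are initialised to zero, $m_{-t'-1}^i=v_{-t'-1}^i=0$, and for all $s\ge -t'$ $$m_s^i=\beta_1 m_{s-1}^i+(1-\beta_1)g_s^i,\qquad v_s^i=\beta_2 v_{s-1}^i+(1-\beta_2)(g_s^i)^2.$$ The bias-corrected terms divide by $1-\beta^{n}$, where $n$ is the number of gradients processed since the last reset of the counter. Since the counter is reset just before timestep $0$, for $t\ge 0$ one has $n=t+1$, so $$\hat m_{-t',t}^i=\frac{m_t^i}{1-\beta_1^{t+1}},\qquad \hat v_{-t',t}^i=\frac{v_t^i}{1-\beta_2^{t+1}}.$$ The general update is $\hat m^i_{-t',t}/(\sqrt{\hat v^i_{-t',t}}+\epsilon)$, taken here with $\epsilon=0$. *)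

theory Defs
  imports "HOL-Analysis.Analysis"
begin

text \<open>
  One parameter coordinate. \<open>fst_moment\<close> and \<open>snd_moment\<close> are the uncorrected moment estimates;
  \<open>counter\<close> is the number of gradients processed since the counter was last reset.
\<close>

record adam_state =
  fst_moment :: real
  snd_moment :: real
  counter :: nat

definition adam_init :: adam_state where
  "adam_init = \<lparr>fst_moment = 0, snd_moment = 0, counter = 0\<rparr>"

definition adam_step :: "real \<Rightarrow> real \<Rightarrow> real \<Rightarrow> adam_state \<Rightarrow> adam_state" where
  "adam_step \<beta>1 \<beta>2 x S =
     \<lparr>fst_moment = \<beta>1 * fst_moment S + (1 - \<beta>1) * x,
      snd_moment = \<beta>2 * snd_moment S + (1 - \<beta>2) * x\<^sup>2,
      counter = Suc (counter S)\<rparr>"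

definition adam_rel_reset :: "adam_state \<Rightarrow> adam_state" where
  "adam_rel_reset S = S\<lparr>counter := 0\<rparr>"

text \<open>
  \<open>adam_rel_run \<beta>1 \<beta>2 C \<gamma> s0 j\<close> is the state after \<open>j\<close> gradients, namely those of the timesteps
  \<open>s0, \<dots>, s0 + j - 1\<close>, when \<open>\<gamma> s\<close> is the gradient at timestep \<open>s\<close> and the objective changes just
  before each timestep in \<open>C\<close>.  The gradients are a prescribed sequence, so the
  parameter itself, and with it the learning rate, is not part of the state.
\<close>

primrec adam_rel_run ::
    "real \<Rightarrow> real \<Rightarrow> int set \<Rightarrow> (int \<Rightarrow> real) \<Rightarrow> int \<Rightarrow> nat \<Rightarrow> adam_state" where
  "adam_rel_run \<beta>1 \<beta>2 C \<gamma> s0 0 = adam_init"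
| "adam_rel_run \<beta>1 \<beta>2 C \<gamma> s0 (Suc j) =
     (let s = s0 + int j; S = adam_rel_run \<beta>1 \<beta>2 C \<gamma> s0 j
      in adam_step \<beta>1 \<beta>2 (\<gamma> s) (if s \<in> C then adam_rel_reset S else S))"

text \<open>
  The state once the gradient of timestep \<open>s\<close> has been processed; only \<open>s \<ge> s0 - 1\<close> is
  meaningful, \<open>s0 - 1\<close> giving the initial state.
\<close>

definition adam_rel_at ::
    "real \<Rightarrow> real \<Rightarrow> int set \<Rightarrow> (int \<Rightarrow> real) \<Rightarrow> int \<Rightarrow> int \<Rightarrow> adam_state" where
  "adam_rel_at \<beta>1 \<beta>2 C \<gamma> s0 s = adam_rel_run \<beta>1 \<beta>2 C \<gamma> s0 (nat (s - s0 + 1))"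

definition m_hat :: "real \<Rightarrow> adam_state \<Rightarrow> real" where
  "m_hat \<beta>1 S = fst_moment S / (1 - \<beta>1 ^ counter S)"

definition v_hat :: "real \<Rightarrow> adam_state \<Rightarrow> real" where
  "v_hat \<beta>2 S = snd_moment S / (1 - \<beta>2 ^ counter S)"

definition adam_update :: "real \<Rightarrow> real \<Rightarrow> real \<Rightarrow> adam_state \<Rightarrow> real" where
  "adam_update \<beta>1 \<beta>2 \<epsilon> S = m_hat \<beta>1 S / (sqrt (v_hat \<beta>2 S) + \<epsilon>)"

lemma adam_update_eps_zero: "adam_update \<beta>1 \<beta>2 0 S = m_hat \<beta>1 S / sqrt (v_hat \<beta>2 S)"
  by (simp add: adam_update_def)

definition scaled_gradients :: "real \<Rightarrow> real \<Rightarrow> int \<Rightarrow> real" where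
  "scaled_gradients g k s = (if s < 0 then g else k * g)"

lemma adam_rel_at_init: "adam_rel_at \<beta>1 \<beta>2 C \<gamma> s0 (s0 - 1) = adam_init"
  by (simp add: adam_rel_at_def)

lemma adam_rel_at_rec:
  assumes "s0 \<le> s"
  shows "adam_rel_at \<beta>1 \<beta>2 C \<gamma> s0 s =
    adam_step \<beta>1 \<beta>2 (\<gamma> s)
      (if s \<in> C then adam_rel_reset (adam_rel_at \<beta>1 \<beta>2 C \<gamma> s0 (s - 1))
       else adam_rel_at \<beta>1 \<beta>2 C \<gamma> s0 (s - 1))"
proof -
  have "nat (s - s0 + 1) = Suc (nat (s - s0))" using assms by simp
  then show ?thesis using assms by (simp add: adam_rel_at_def Let_def)
qed

lemma moments_rec:
  assumes "s0 \<le> s"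
  shows "fst_moment (adam_rel_at \<beta>1 \<beta>2 C \<gamma> s0 s) =
           \<beta>1 * fst_moment (adam_rel_at \<beta>1 \<beta>2 C \<gamma> s0 (s - 1)) + (1 - \<beta>1) * \<gamma> s"
    and "snd_moment (adam_rel_at \<beta>1 \<beta>2 C \<gamma> s0 s) =
           \<beta>2 * snd_moment (adam_rel_at \<beta>1 \<beta>2 C \<gamma> s0 (s - 1)) + (1 - \<beta>2) * (\<gamma> s)\<^sup>2"
  by (simp_all add: adam_rel_at_rec[OF assms] adam_step_def adam_rel_reset_def)

lemma counter_after_reset:
  assumes "s0 \<le> 0"
  shows "counter (adam_rel_at \<beta>1 \<beta>2 {0} \<gamma> s0 (int t)) = t + 1"
proof (induction t)
  case 0
  show ?case using assms by (simp add: adam_rel_at_rec adam_step_def adam_rel_reset_def)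
next
  case (Suc t)
  then show ?case using assms by (simp add: adam_rel_at_rec[of s0 "1 + int t"] adam_step_def)
qed

end

theory Submission
  imports Defs
begin

text \<open>
  A moment estimate is an exponential moving average, so on gradients that are constant before and
  after timestep \<open>0\<close> it is an explicit combination of the two values; only the start-up factor
  \<open>1 - \<beta> ^ t'\<close> on the old value depends on \<open>t'\<close>, and it tends to \<open>1\<close>.
\<close>

text \<open>The recursion is kept abstract so that it serves both moments: \<open>x\<close> and
  \<open>y\<close> become the two gradients for one and their squares for the other.\<close>

lemma ema_step_input:
  fixes M :: "int \<Rightarrow> real" and b x y :: real
  assumes init: "M (- int n - 1) = 0"
    and rec: "\<And>s. - int n \<le> s \<Longrightarrow> M s = b * M (s - 1) + (1 - b) * (if s < 0 then x else y)"
  shows "M (int t) = b ^ (t + 1) * ((1 - b ^ n) * x) + (1 - b ^ (t + 1)) * y"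
proof -
  \<comment> \<open>Here \<open>j\<close> counts processed gradients, and the state after
    \<open>j\<close> of them sits at timestep \<open>j - n - 1\<close>; so \<open>j = n\<close> is
    timestep \<open>-1\<close>, the last one before the change.\<close>
  have pre: "j \<le> n \<Longrightarrow> M (int j - int n - 1) = (1 - b ^ j) * x" for j
  proof (induction j)
    case 0
    then show ?case using init by simp
  next
    case (Suc j)
    have "M (int (Suc j) - int n - 1) = b * M (int j - int n - 1) + (1 - b) * x"
      using rec[of "int j - int n"] Suc.prems by simp
    also have "M (int j - int n - 1) = (1 - b ^ j) * x"
      using Suc by simp
    finally show ?case by (simp add: algebra_simps)
  qed
  have before: "M (- 1) = (1 - b ^ n) * x"
    using pre[of n] by simp
  show ?thesis
  proof (induction t)
    case 0
    show ?case using rec[of 0] before by simp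
  next
    case (Suc t)
    have "M (int (Suc t)) = b * M (int t) + (1 - b) * y"
      using rec[of "int (Suc t)"] by simp
    then show ?case unfolding Suc by (simp add: algebra_simps)
  qed
qed

text \<open>The set \<open>C\<close> of resets is arbitrary because a reset changes the counter and
  leaves the moments alone.\<close>

lemma fst_moment_scaled_gradients:
  "fst_moment (adam_rel_at \<beta>1 \<beta>2 C (scaled_gradients g k) (- int n) (int t)) =
     \<beta>1 ^ (t + 1) * ((1 - \<beta>1 ^ n) * g) + (1 - \<beta>1 ^ (t + 1)) * (k * g)"
proof (rule ema_step_input)
  show "fst_moment (adam_rel_at \<beta>1 \<beta>2 C (scaled_gradients g k) (- int n) (- int n - 1)) = 0"
    by (simp only: adam_rel_at_init adam_init_def adam_state.simps)
qed (simp add: moments_rec scaled_gradients_def)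

lemma snd_moment_scaled_gradients:
  "snd_moment (adam_rel_at \<beta>1 \<beta>2 C (scaled_gradients g k) (- int n) (int t)) =
     \<beta>2 ^ (t + 1) * ((1 - \<beta>2 ^ n) * g\<^sup>2) + (1 - \<beta>2 ^ (t + 1)) * (k * g)\<^sup>2"
proof (rule ema_step_input)
  show "snd_moment (adam_rel_at \<beta>1 \<beta>2 C (scaled_gradients g k) (- int n) (- int n - 1)) = 0"
    by (simp only: adam_rel_at_init adam_init_def adam_state.simps)
qed (simp add: moments_rec scaled_gradients_def)

text \<open>Dividing the numerator by \<open>k\<close> and the radicand by \<open>k\<^sup>2\<close>
  leaves \<open>a / k\<close> and \<open>b / k\<^sup>2\<close>, which vanish. The quotient tends to
  the reciprocal of the prefactor.\<close>

lemma affine_over_sqrt_quadratic_tendsto: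
  fixes a b :: real
  assumes "a < 1" and "b < 1"
  shows "((\<lambda>k. sqrt (1 - b) / (1 - a) * ((a + k * (1 - a)) / sqrt (b + k\<^sup>2 * (1 - b)))) \<longlongrightarrow> 1) at_top"
proof -
  have "((\<lambda>k. (a / k + (1 - a)) / sqrt (b / k\<^sup>2 + (1 - b))) \<longlongrightarrow> (0 + (1 - a)) / sqrt (0 + (1 - b))) at_top"
    using assms by (intro tendsto_intros tendsto_divide_0[OF tendsto_const]
        filterlim_at_top_imp_at_infinity filterlim_pow_at_top filterlim_ident) auto
  \<comment> \<open>Positive \<open>k\<close> is where \<open>sqrt (k\<^sup>2) = k\<close>.\<close>
  moreover have "\<forall>\<^sub>F k in at_top.
      (a / k + (1 - a)) / sqrt (b / k\<^sup>2 + (1 - b)) = (a + k * (1 - a)) / sqrt (b + k\<^sup>2 * (1 - b))"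
    using eventually_gt_at_top[of 0]
  proof eventually_elim
    case (elim k)
    have "a + k * (1 - a) = k * (a / k + (1 - a))"
      and "b + k\<^sup>2 * (1 - b) = k\<^sup>2 * (b / k\<^sup>2 + (1 - b))"
      using elim by (simp_all add: field_simps)
    then show ?case
      using elim by (simp add: real_sqrt_mult)
  qed
  ultimately have "((\<lambda>k. (a + k * (1 - a)) / sqrt (b + k\<^sup>2 * (1 - b))) \<longlongrightarrow> (1 - a) / sqrt (1 - b)) at_top"
    by (simp add: filterlim_cong)
  from tendsto_mult_left[OF this, of "sqrt (1 - b) / (1 - a)"] show ?thesis
    using assms by simp
qed

theorem mainTheorem2:
  fixes \<beta>1 \<beta>2 g k :: real
  assumes "0 \<le> \<beta>1" and "\<beta>1 < 1" and "0 \<le> \<beta>2" and "\<beta>2 < 1"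
    and "0 < g" and "0 < k"
  shows "(\<forall>t :: nat.
      (\<lambda>t' :: nat.
          m_hat \<beta>1 (adam_rel_at \<beta>1 \<beta>2 {0} (scaled_gradients g k) (- int t') (int t))
          / sqrt (v_hat \<beta>2 (adam_rel_at \<beta>1 \<beta>2 {0} (scaled_gradients g k) (- int t') (int t))))
        \<longlonglongrightarrow> sqrt (1 - \<beta>2 ^ (t + 1)) / (1 - \<beta>1 ^ (t + 1))
           * ((\<beta>1 ^ (t + 1) + k * (1 - \<beta>1 ^ (t + 1)))
              / sqrt (\<beta>2 ^ (t + 1) + k\<^sup>2 * (1 - \<beta>2 ^ (t + 1)))))
    \<and> (\<forall>t :: nat.
      ((\<lambda>k :: real. sqrt (1 - \<beta>2 ^ (t + 1)) / (1 - \<beta>1 ^ (t + 1))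
           * ((\<beta>1 ^ (t + 1) + k * (1 - \<beta>1 ^ (t + 1)))
              / sqrt (\<beta>2 ^ (t + 1) + k\<^sup>2 * (1 - \<beta>2 ^ (t + 1)))))
        \<longlongrightarrow> 1) at_top)"
proof (intro conjI allI)
  fix t :: nat
  \<comment> \<open>These are the weights of the past in the two moments at timestep
    \<open>t\<close>. As the reset makes the counter \<open>t + 1\<close>, the bias corrections are
    \<open>1 - a\<close> and \<open>1 - b\<close>.\<close>
  define a where "a = \<beta>1 ^ (t + 1)"
  define b where "b = \<beta>2 ^ (t + 1)"
  have b: "0 \<le> b" "b < 1"
    using assms by (simp_all add: b_def power_less_one_iff del: power_Suc)
  \<comment> \<open>\<open>b\<close> vanishes when \<open>\<beta>2 = 0\<close>, so positivity comes
    from the second summand.\<close>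
  have pos: "0 < b + k\<^sup>2 * (1 - b)"
    using b \<open>0 < k\<close> by (simp add: add_nonneg_pos)
  let ?S = "\<lambda>n. adam_rel_at \<beta>1 \<beta>2 {0} (scaled_gradients g k) (- int n) (int t)"
  have m: "m_hat \<beta>1 (?S n) = (a * ((1 - \<beta>1 ^ n) * g) + (1 - a) * (k * g)) / (1 - a)" for n
    by (simp add: m_hat_def counter_after_reset fst_moment_scaled_gradients a_def)
  have v: "v_hat \<beta>2 (?S n) = (b * ((1 - \<beta>2 ^ n) * g\<^sup>2) + (1 - b) * (k * g)\<^sup>2) / (1 - b)" for n
    by (simp add: v_hat_def counter_after_reset snd_moment_scaled_gradients b_def)
  have vlim: "(b * ((1 - 0) * g\<^sup>2) + (1 - b) * (k * g)\<^sup>2) / (1 - b) = g\<^sup>2 * (b + k\<^sup>2 * (1 - b)) / (1 - b)"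
    by (simp add: algebra_simps power_mult_distrib)
  have "(\<lambda>n. m_hat \<beta>1 (?S n) / sqrt (v_hat \<beta>2 (?S n))) \<longlonglongrightarrow>
      (a * ((1 - 0) * g) + (1 - a) * (k * g)) / (1 - a)
      / sqrt ((b * ((1 - 0) * g\<^sup>2) + (1 - b) * (k * g)\<^sup>2) / (1 - b))"
    \<comment> \<open>Multiplication by a constant inverse passes to the limit without a side
      condition. The division by the root remains and needs a nonzero limit.\<close>
    unfolding m v divide_inverse[of _ "1 - a"] divide_inverse[of _ "1 - b"]
  proof (intro tendsto_intros LIMSEQ_power_zero)
    show "sqrt ((b * ((1 - 0) * g\<^sup>2) + (1 - b) * (k * g)\<^sup>2) * inverse (1 - b)) \<noteq> 0"
      using vlim pos b \<open>0 < g\<close> by (simp add: divide_inverse)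
  qed (use assms in auto)
  also have "(a * ((1 - 0) * g) + (1 - a) * (k * g)) / (1 - a)
      / sqrt ((b * ((1 - 0) * g\<^sup>2) + (1 - b) * (k * g)\<^sup>2) / (1 - b)) =
      sqrt (1 - b) / (1 - a) * ((a + k * (1 - a)) / sqrt (b + k\<^sup>2 * (1 - b)))"
  proof -
    have "a * ((1 - 0) * g) + (1 - a) * (k * g) = g * (a + k * (1 - a))"
      by (simp add: algebra_simps)
    \<comment> \<open>Since \<open>g > 0\<close>, the root of \<open>g\<^sup>2\<close> is
      \<open>g\<close>, which cancels against the factor in the numerator.\<close>
    then show ?thesis
      unfolding vlim using \<open>0 < g\<close> by (simp add: real_sqrt_mult real_sqrt_divide)
  qed
  finally show "(\<lambda>n. m_hat \<beta>1 (?S n) / sqrt (v_hat \<beta>2 (?S n))) \<longlonglongrightarrow>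
      sqrt (1 - \<beta>2 ^ (t + 1)) / (1 - \<beta>1 ^ (t + 1))
      * ((\<beta>1 ^ (t + 1) + k * (1 - \<beta>1 ^ (t + 1))) / sqrt (\<beta>2 ^ (t + 1) + k\<^sup>2 * (1 - \<beta>2 ^ (t + 1))))"
    unfolding a_def b_def .
next
  fix t :: nat
  have "\<beta>1 ^ (t + 1) < 1" and "\<beta>2 ^ (t + 1) < 1"
    using assms by (simp_all add: power_less_one_iff del: power_Suc)
  then show "((\<lambda>k :: real. sqrt (1 - \<beta>2 ^ (t + 1)) / (1 - \<beta>1 ^ (t + 1))
      * ((\<beta>1 ^ (t + 1) + k * (1 - \<beta>1 ^ (t + 1)))
         / sqrt (\<beta>2 ^ (t + 1) + k\<^sup>2 * (1 - \<beta>2 ^ (t + 1))))) \<longlongrightarrow> 1) at_top"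
    by (rule affine_over_sqrt_quadratic_tendsto)
qed

end
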